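(* Consider an instance of the PRTRP with $n$ fault locations. Given a return path $P$ that contains $k$ vertices in $V_c$, the total service disruption time of any Hamiltonian cycle extended from $P$ is lower bounded by $$\sum_{p=1}^{n-k+1}(n+1-p)\,s_p+v^B(P).$$
   Context: Instance of the Power Restoration Traveling Repairman Problem (PRTRP): Let $n\ge 1$, let $V_c=\{1,2,\dots,n\}$ be the set of fault locations (customers), let vertex $0$ be the depot, and let $V=V_c\cup\{0\}$. The road network is a complete directed graph $G=(V,A)$, where each arc $(i,j)\in A$ ($i\neq j$) represents a shortest path from location $i$ to location $j$ and has travel time (length) $d_{ij}\ge 0$. The power network is a directed tree $T=(V_c,A_c)$ rooted at vertex $1$ (the unique power source, with all arcs directed away from it). Write $i\succeq j$ if $i=j$ or $j$ is reachable from $i$ by a directed path in $T$. Repair durations are zero. Solutions and objective: A solution is a Hamiltonian cycle $H=(j_0=0,j_1,\dots,j_n,0)$ in $G$ starting at the depot. The crew leaves the depot at time $0$ and arrives at $j_p$ at time $t_{j_p}=\sum_{q=1}^{p}d_{j_{q-1}j_q}$, repairing the fault there instantaneously. The service disruption time of $j\in V_c$ is $r_j=\max\{t_i : i\succeq j\}$. The total service disruption time of $H$ is $\sum_{j\in V_c}r_j$. For $S\subseteq V$, let $W(S)$ be the number of vertices $j\in V_c$ without power when exactly the vertices in $S\cap V_c$ have been repaired, i.e., the number of $j\in V_c$ such that some $i\succeq j$ is not in $S$. Return paths: A return path is a (simple) path $P$ in $G$ that starts at some vertex $i\in V_c$ and ends at vertex $0$; $V(P)$ is its set of vertices. $v^B(P)$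 is the service disruption time accumulated by all customers in $V_c$ between the time the vehicle arrives at the starting vertex of $P$ and the time it returns to vertex $0$ following $P$, where the customers in $V_c\setminus V(P)$ have been visited before. Explicitly, if $P=(i_1,\dots,i_k,0)$ then $v^B(P)=\sum_{q=2}^{k}W(V_c\setminus\{i_q,\dots,i_k\})\,d_{i_{q-1}i_q}$. A Hamiltonian cycle is extended from $P$ if it ends with $P$, i.e., it is the concatenation of a path starting at $0$ with $P$. Notation: $s_p$ is the length of the $p$-th shortest arc in the road network $G$ (arc lengths sorted in non-decreasing order, with multiplicity). *)

theory Defs
  imports "Graph_Theory.Graph_Theory" "HOL-Library.Multiset"
begin

definition road_network :: "nat \<Rightarrow> nat pair_pre_digraph" where
  "road_network n =
    \<lparr> pverts = {0..n}, parcs = {(i, j). i \<in> {0..n} \<and> j \<in> {0..n} \<and> i \<noteq> j} \<rparr>"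

(* The library's "tree" only forbids directed cycles and hence is not an arborescence. *)
definition rooted_directed_tree :: "('a, 'b) pre_digraph \<Rightarrow> 'a \<Rightarrow> bool" where
  "rooted_directed_tree T r \<longleftrightarrow>
    wf_digraph T \<and> r \<in> verts T \<and> (\<forall>v \<in> verts T. \<exists>!p. pre_digraph.awalk T r p v)"

(* A cycle is the closed list [j_0, ..., j_n, j_0]; its first vertex is repeated at the end. *)
definition hamiltonian_cycle :: "('a, 'b) pre_digraph \<Rightarrow> 'a vwalk \<Rightarrow> bool" where
  "hamiltonian_cycle G H \<longleftrightarrow>
    vwalk H G \<and> hd H = last H \<and> distinct (tl H) \<and> set (tl H) = verts G"

definition prtrp_solution :: "nat \<Rightarrow> nat vwalk \<Rightarrow> bool" where
  "prtrp_solution n H \<longleftrightarrow> hamiltonian_cycle (with_proj (road_network n)) H \<and> hd H = 0"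

(* Customers occur exactly once in a solution, so LEAST picks their unique position;
   for the depot it gives the departure, i.e. time 0. *)
definition arrival_time :: "(nat \<Rightarrow> nat \<Rightarrow> real) \<Rightarrow> nat vwalk \<Rightarrow> nat \<Rightarrow> real" where
  "arrival_time d H v = (\<Sum>q = 1..(LEAST p. p < length H \<and> H ! p = v). d (H ! (q - 1)) (H ! q))"

definition disruption_time ::
  "(nat \<Rightarrow> nat \<Rightarrow> real) \<Rightarrow> nat pair_pre_digraph \<Rightarrow> nat vwalk \<Rightarrow> nat \<Rightarrow> real" where
  "disruption_time d T H j = Max {arrival_time d H i | i. i \<rightarrow>\<^sup>*\<^bsub>with_proj T\<^esub> j}"

definition total_disruption ::
  "(nat \<Rightarrow> nat \<Rightarrow> real) \<Rightarrow> nat pair_pre_digraph \<Rightarrow> nat vwalk \<Rightarrow> real" where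
  "total_disruption d T H = (\<Sum>j \<in> pverts T. disruption_time d T H j)"

definition without_power :: "nat pair_pre_digraph \<Rightarrow> nat set \<Rightarrow> nat" where
  "without_power T S = card {j \<in> pverts T. \<exists>i. i \<rightarrow>\<^sup>*\<^bsub>with_proj T\<^esub> j \<and> i \<notin> S}"

definition return_path :: "nat \<Rightarrow> nat vwalk \<Rightarrow> bool" where
  "return_path n P \<longleftrightarrow> vpath P (with_proj (road_network n)) \<and> hd P \<in> {1..n} \<and> last P = 0"

(* For P = [i_1, ..., i_k, 0] we have k = length P - 1 and i_q = P ! (q - 1). *)
definition return_disruption ::
  "(nat \<Rightarrow> nat \<Rightarrow> real) \<Rightarrow> nat pair_pre_digraph \<Rightarrow> nat vwalk \<Rightarrow> real" where
  "return_disruption d T P =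
    (let k = length P - 1; i = (\<lambda>q. P ! (q - 1))
     in \<Sum>q = 2..k. real (without_power T (pverts T - i ` {q..k})) * d (i (q - 1)) (i q))"

(* The initial path ends in the first vertex of P, which vwalk_join identifies. *)
definition extended_from :: "nat \<Rightarrow> nat vwalk \<Rightarrow> nat vwalk \<Rightarrow> bool" where
  "extended_from n H P \<longleftrightarrow>
    (\<exists>Q. vpath Q (with_proj (road_network n)) \<and> hd Q = 0 \<and> joinable Q P \<and> H = vwalk_join Q P)"

definition shortest_arc_length :: "nat \<Rightarrow> (nat \<Rightarrow> nat \<Rightarrow> real) \<Rightarrow> nat \<Rightarrow> real" where
  "shortest_arc_length n d p =
    sorted_list_of_multiset
      (image_mset (\<lambda>(i, j). d i j) (mset_set (parcs (road_network n)))) ! (p - 1)"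

end

theory Submission
  imports Defs
begin

text \<open>
  Write a solution as \<open>H = (j\<^sub>0, j\<^sub>1, \<dots>, j\<^sub>n, 0)\<close>. Counting the disruption arc by arc
  instead of customer by customer gives
  \<open>(\<Sum>q = 1..n. W {j\<^sub>1, \<dots>, j\<^sub>q\<^sub>-\<^sub>1} * d j\<^sub>q\<^sub>-\<^sub>1 j\<^sub>q)\<close>, where \<open>W S\<close> is the number of customers
  still without power when exactly \<open>S\<close> has been repaired: the \<open>q\<close>-th arc delays precisely those
  customers that are dark while it is traversed (\<open>total_disruption_eq_sum\<close>).

  If \<open>H\<close> ends with a return path through \<open>k\<close> customers, then the last \<open>k - 1\<close> of these terms
  are exactly the disruption of that path (\<open>return_disruption_eq_sum\<close>). In each of the other
  \<open>n - k + 1\<close> terms, at most \<open>q - 1\<close> of the \<open>n\<close> customers have been repaired and an unrepaired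
  customer is dark, so the weight is at least \<open>n + 1 - q\<close>.

  It remains to compare \<open>(\<Sum>q = 1..n - k + 1. (n + 1 - q) * d j\<^sub>q\<^sub>-\<^sub>1 j\<^sub>q)\<close> with the same sum over
  the shortest arcs of the network. The arcs of \<open>H\<close> are pairwise distinct, so any first \<open>j\<close> of
  them are together at least as long as the \<open>j\<close> shortest arcs (\<open>sum_shortest_arc_length_le\<close>).
  The weights decrease in \<open>q\<close>, so summation by parts carries this comparison of prefix sums over
  to the weighted sums (\<open>sum_antimono_weights_le\<close>).
\<close>

section \<open>Weighted sums against the shortest entries\<close>

text \<open>
  By induction on the list: \<open>N\<close> has an element that is at least the head of the list and whose
  removal leaves a submultiset of the tail, namely the head itself if it occurs in \<open>N\<close>, and any
  element otherwise.
\<close>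

lemma sum_list_take_le_sum_mset:
  fixes xs :: "'a :: {linorder, ordered_ab_group_add} list"
  assumes "sorted xs" and "N \<subseteq># mset xs"
  shows "sum_list (take (size N) xs) \<le> sum_mset N"
  using assms
proof (induction xs arbitrary: N)
  case (Cons x xs)
  show ?case
  proof (cases "N = {#}")
    case False
    have "\<exists>y \<in># N. x \<le> y \<and> N - {#y#} \<subseteq># mset xs"
    proof (cases "x \<in># N")
      case True
      then show ?thesis
        using Cons.prems(2) by (metis mset.simps(2) order_refl subset_eq_diff_conv add_mset_add_single)
    next
      case x_notin: False
      obtain y where y: "y \<in># N"
        using \<open>N \<noteq> {#}\<close> by blast
      then have "y \<in> set (x # xs)"
        using Cons.prems(2) by (metis mset_subset_eqD set_mset_mset)
      then have "x \<le> y"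
        using Cons.prems(1) by auto
      moreover have "N \<subseteq># mset xs"
        using x_notin Cons.prems(2) by (metis diff_single_trivial mset.simps(2) subset_eq_diff_conv add_mset_add_single)
      ultimately show ?thesis
        using y by (meson diff_subset_eq_self subset_mset.order_trans)
    qed
    then obtain y where y: "y \<in># N" "x \<le> y" "N - {#y#} \<subseteq># mset xs"
      by blast
    have "sum_list (take (size (N - {#y#})) xs) \<le> sum_mset (N - {#y#})"
      using Cons.IH Cons.prems(1) y(3) by simp
    with y(2) have "x + sum_list (take (size (N - {#y#})) xs) \<le> y + sum_mset (N - {#y#})"
      by (rule add_mono)
    then show ?thesis
      using y(1) by (simp add: sum_mset.remove[OF y(1)] size_Suc_Diff1[symmetric] del: size_Suc_Diff1)
  qed simp
qed simp

text \<open>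
  Summation by parts in inductive form. With \<open>E j\<close> the difference of the \<open>j\<close>-th prefix sums, the
  weighted difference up to \<open>j\<close> is at least \<open>w j * E j\<close>: lowering the weight from \<open>w j\<close> to
  \<open>w (Suc j)\<close> cannot increase \<open>w j * E j\<close>, because \<open>E j\<close> is nonnegative.
\<close>

lemma sum_antimono_weights_le:
  fixes a s w :: "nat \<Rightarrow> 'a :: linordered_idom"
  assumes prefix: "\<And>j. j \<le> m \<Longrightarrow> (\<Sum>p = 1..j. s p) \<le> (\<Sum>p = 1..j. a p)"
    and antimono: "\<And>p. 1 \<le> p \<Longrightarrow> p < m \<Longrightarrow> w (Suc p) \<le> w p"
    and nonneg: "w m \<ge> 0"
  shows "(\<Sum>p = 1..m. w p * s p) \<le> (\<Sum>p = 1..m. w p * a p)"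
proof -
  define E where "E j = (\<Sum>p = 1..j. a p - s p)" for j
  have E_nonneg: "E j \<ge> 0" if "j \<le> m" for j
    using prefix[OF that] by (simp add: E_def sum_subtractf)
  have "w j * E j \<le> (\<Sum>p = 1..j. w p * (a p - s p))" if "j \<le> m" for j
    using that
  proof (induction j)
    case (Suc j)
    have "w (Suc j) * E j \<le> w j * E j"
    proof (cases "j = 0")
      case False
      then show ?thesis
        using Suc.prems antimono[of j] E_nonneg[of j] by (intro mult_right_mono) auto
    qed (simp add: E_def)
    also have "\<dots> \<le> (\<Sum>p = 1..j. w p * (a p - s p))"
      using Suc by simp
    finally show ?case
      by (simp add: E_def distrib_left)
  qed (simp add: E_def)
  from this[of m] have "0 \<le> (\<Sum>p = 1..m. w p * (a p - s p))"
    using nonneg E_nonneg[of m] by (meson mult_nonneg_nonneg order_refl order_trans)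
  then show ?thesis
    by (simp add: right_diff_distrib sum_subtractf)
qed

text \<open>
  Arc lengths may coincide, so the comparison is between multisets: injectivity of \<open>f\<close> makes the
  lengths of the chosen arcs a submultiset of all arc lengths. In particular there are at least
  \<open>j\<close> arcs, so the first \<open>j\<close> positions of the sorted list exist.
\<close>

lemma sum_shortest_arc_length_le:
  assumes "inj_on f {1..j}" and "\<And>p. p \<in> {1..j} \<Longrightarrow> f p \<in> parcs (road_network n)"
  shows "(\<Sum>p = 1..j. shortest_arc_length n d p) \<le> (\<Sum>p = 1..j. case f p of (u, v) \<Rightarrow> d u v)"
proof -
  let ?A = "parcs (road_network n)"
  let ?len = "\<lambda>(u, v). d u v"
  let ?L = "image_mset ?len (mset_set ?A)"
  let ?N = "image_mset ?len (mset_set (f ` {1..j}))"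
  have "finite ?A"
    by (rule finite_subset[of _ "{0..n} \<times> {0..n}"]) (auto simp: road_network_def)
  then have sub: "?N \<subseteq># ?L"
    using assms(2) by (intro image_mset_subseteq_mono subset_imp_msubset_mset_set) auto
  have size: "size ?N = j"
    using assms(1) by (simp add: card_image)
  let ?xs = "sorted_list_of_multiset ?L"
  have j_le: "j \<le> length ?xs"
    using size_mset_mono[OF sub] size by (metis mset_sorted_list_of_multiset size_mset)
  have "(\<Sum>p = 1..j. shortest_arc_length n d p) = (\<Sum>i < j. ?xs ! i)"
    unfolding shortest_arc_length_def
    by (rule sum.reindex_bij_witness[of _ Suc "\<lambda>p. p - 1"]) auto
  also have "\<dots> = sum_list (take (size ?N) ?xs)"
    using j_le size by (simp add: sum_list_sum_nth lessThan_atLeast0)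
  also have "\<dots> \<le> sum_mset ?N"
    using sub by (intro sum_list_take_le_sum_mset) auto
  also have "\<dots> = (\<Sum>p = 1..j. ?len (f p))"
    using assms(1) by (simp add: sum_unfold_sum_mset[symmetric] sum.reindex)
  finally show ?thesis .
qed

section \<open>Disruption along a solution\<close>

lemma vwalk_nth_arc:
  assumes "vwalk p G" and "0 < q" and "q < length p"
  shows "(p ! (q - 1), p ! q) \<in> arcs_ends G"
proof -
  have "last (take q p) = p ! (q - 1)"
    using assms(2,3) by (subst last_conv_nth) auto
  then have "vwalk_arcs (take q p @ drop q p) =
    vwalk_arcs (take q p) @ (p ! (q - 1), p ! q) # vwalk_arcs (drop q p)"
    using assms(2,3)
    by (subst vwalk_arcs_append) (auto simp: hd_drop_conv_nth)
  then have "(p ! (q - 1), p ! q) \<in> set (vwalk_arcs p)"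
    by simp
  then show ?thesis
    using assms(1) by blast
qed

lemma prtrp_solutionD:
  assumes "prtrp_solution n H"
  shows length_solution: "length H = n + 2"
    and inj_on_solution: "inj_on ((!) H) {1..n + 1}"
    and image_solution: "(!) H ` {1..n} = {1..n}"
    and solution_arc: "q \<in> {1..n + 1} \<Longrightarrow> (H ! (q - 1), H ! q) \<in> parcs (road_network n)"
proof -
  have walk: "vwalk H (with_proj (road_network n))" and closed: "last H = 0"
    and dist: "distinct (tl H)" and set_tl: "set (tl H) = {0..n}"
    using assms by (auto simp: prtrp_solution_def hamiltonian_cycle_def road_network_def)
  have ne: "H \<noteq> []"
    using walk by auto
  have "length (tl H) = n + 1"
    using distinct_card[OF dist] set_tl by simp
  then show len: "length H = n + 2"
    by simp
  have nth_tl': "H ! q = tl H ! (q - 1)" if "q \<in> {1..n + 1}" for q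
    using that len by (cases H) (auto simp: nth_Cons')
  show inj: "inj_on ((!) H) {1..n + 1}"
    using dist len by (auto intro!: inj_onI simp: nth_tl' nth_eq_iff_index_eq)
  have "(!) H ` {1..n + 1} = {0..n}"
  proof -
    have "(!) H ` {1..n + 1} = (!) (tl H) ` {0..<n + 1}"
      by (force simp: image_iff nth_tl' Bex_def intro: exI[of _ "Suc _"])
    also have "\<dots> = set (tl H)"
      using len by (auto simp: set_conv_nth)
    finally show ?thesis
      using set_tl by simp
  qed
  moreover have "H ! (n + 1) = 0"
    using closed len ne by (simp add: last_conv_nth)
  moreover have "{1..n} = {1..n + 1} - {n + 1}"
    by auto
  ultimately show "(!) H ` {1..n} = {1..n}"
    using inj by (auto simp: inj_on_image_set_diff[OF inj])
  show "(H ! (q - 1), H ! q) \<in> parcs (road_network n)" if "q \<in> {1..n + 1}"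
    using vwalk_nth_arc[OF walk, of q] that len by simp
qed

text \<open>
  Position 0 holds the depot and the other positions up to the final return hold distinct
  vertices, so a customer occurs at a single position.
\<close>

lemma arrival_time_nth:
  assumes "prtrp_solution n H" and "p \<in> {1..n}"
  shows "arrival_time d H (H ! p) = (\<Sum>q = 1..p. d (H ! (q - 1)) (H ! q))"
proof -
  have "H ! 0 = 0"
    using assms(1) length_solution[OF assms(1)]
    by (cases H) (auto simp: prtrp_solution_def)
  moreover have "H ! p \<in> {1..n}"
    using image_solution[OF assms(1)] assms(2) by blast
  ultimately have "p' \<in> {1..n + 1}" if "p' < length H" "H ! p' = H ! p" for p'
    using that length_solution[OF assms(1)] by (cases p') auto
  then have "p' = p" if "p' < length H" "H ! p' = H ! p" for p'
    using that inj_onD[OF inj_on_solution[OF assms(1)], of p' p] assms(2) by simp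
  then have "(LEAST p'. p' < length H \<and> H ! p' = H ! p) = p"
    using assms(2) length_solution[OF assms(1)] by (intro Least_equality) auto
  then show ?thesis
    by (simp add: arrival_time_def)
qed

text \<open>
  Arrival times never decrease along the tour, so \<open>j\<close> regains power when the last customer
  \<open>i \<succeq> j\<close> of the tour, say at position \<open>M\<close>, is visited. The arcs traversed until then are those
  with \<open>q \<le> M\<close>, that is, those at whose traversal some customer \<open>i \<succeq> j\<close> is still unrepaired.
\<close>

lemma disruption_time_eq_sum:
  assumes sol: "prtrp_solution n H"
    and nonneg: "\<And>i j. (i, j) \<in> parcs (road_network n) \<Longrightarrow> d i j \<ge> 0"
    and verts: "pverts T = {1..n}" and j: "j \<in> {1..n}"
  shows "disruption_time d T H j =
    (\<Sum>q = 1..n. if \<exists>i. i \<rightarrow>\<^sup>*\<^bsub>with_proj T\<^esub> j \<and> i \<notin> (!) H ` {1..<q}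
      then d (H ! (q - 1)) (H ! q) else 0)"
proof -
  let ?t = "\<lambda>p. \<Sum>q = 1..p. d (H ! (q - 1)) (H ! q)"
  define A where "A = {p \<in> {1..n}. H ! p \<rightarrow>\<^sup>*\<^bsub>with_proj T\<^esub> j}"
  have anc: "i \<in> (!) H ` A" if "i \<rightarrow>\<^sup>*\<^bsub>with_proj T\<^esub> j" for i
  proof -
    have "i \<in> {1..n}"
      using reachable_in_vertsE[OF that] verts by auto
    then show ?thesis
      using that image_solution[OF sol] by (force simp: A_def)
  qed
  have "j \<rightarrow>\<^sup>*\<^bsub>with_proj T\<^esub> j"
    using j verts by (simp add: reachable_def)
  then have "A \<noteq> {}"
    using anc by blast
  have fin: "finite A"
    by (simp add: A_def)
  define M where "M = Max A"
  have "M \<in> A" and le_M: "\<And>p. p \<in> A \<Longrightarrow> p \<le> M"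
    using fin \<open>A \<noteq> {}\<close> by (auto simp: M_def)
  then have M: "M \<in> {1..n}" "H ! M \<rightarrow>\<^sup>*\<^bsub>with_proj T\<^esub> j"
    by (auto simp: A_def)
  have "{arrival_time d H i | i. i \<rightarrow>\<^sup>*\<^bsub>with_proj T\<^esub> j} = ?t ` A"
  proof -
    have "{arrival_time d H i | i. i \<rightarrow>\<^sup>*\<^bsub>with_proj T\<^esub> j} = arrival_time d H ` (!) H ` A"
      using anc by (auto simp: A_def)
    also have "\<dots> = ?t ` A"
      unfolding image_image by (intro image_cong refl arrival_time_nth[OF sol]) (simp add: A_def)
    finally show ?thesis .
  qed
  moreover have "Max (?t ` A) = ?t M"
  proof (rule Max_eqI)
    fix t assume "t \<in> ?t ` A"
    then obtain p where "p \<in> A" "t = ?t p"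
      by blast
    then show "t \<le> ?t M"
      using le_M[OF \<open>p \<in> A\<close>] M(1)
      by (auto intro!: sum_mono2 nonneg solution_arc[OF sol, simplified])
  qed (use fin \<open>M \<in> A\<close> in auto)
  ultimately have "disruption_time d T H j = ?t M"
    by (simp add: disruption_time_def)
  \<comment> \<open>Padding with zeros makes the range of summation the same for all customers.\<close>
  also have "\<dots> = (\<Sum>q = 1..n. if q \<le> M then d (H ! (q - 1)) (H ! q) else 0)"
    using M(1) by (intro sum.mono_neutral_cong_left) auto
  also have "\<dots> = (\<Sum>q = 1..n. if \<exists>i. i \<rightarrow>\<^sup>*\<^bsub>with_proj T\<^esub> j \<and> i \<notin> (!) H ` {1..<q}
      then d (H ! (q - 1)) (H ! q) else 0)"
  proof (intro sum.cong if_cong refl)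
    fix q assume q: "q \<in> {1..n}"
    have "H ! M \<notin> (!) H ` {1..<q}" if "q \<le> M"
      using that q M(1) by (auto dest!: inj_onD[OF inj_on_solution[OF sol]])
    moreover have "q \<le> M" if i: "i \<rightarrow>\<^sup>*\<^bsub>with_proj T\<^esub> j" "i \<notin> (!) H ` {1..<q}" for i
    proof -
      obtain p where p: "p \<in> A" "i = H ! p"
        using anc[OF i(1)] by blast
      then have "q \<le> p"
        using i(2) by (force simp: A_def)
      then show ?thesis
        using le_M[OF p(1)] by simp
    qed
    ultimately show "q \<le> M \<longleftrightarrow> (\<exists>i. i \<rightarrow>\<^sup>*\<^bsub>with_proj T\<^esub> j \<and> i \<notin> (!) H ` {1..<q})"
      using M(2) by blast
  qed
  finally show ?thesis .
qed

text \<open>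
  Exchanging the sums over customers and arcs turns the conditions of the previous lemma into a
  count of dark customers.
\<close>

lemma total_disruption_eq_sum:
  assumes "prtrp_solution n H"
    and "\<And>i j. (i, j) \<in> parcs (road_network n) \<Longrightarrow> d i j \<ge> 0"
    and "pverts T = {1..n}"
  shows "total_disruption d T H =
    (\<Sum>q = 1..n. real (without_power T ((!) H ` {1..<q})) * d (H ! (q - 1)) (H ! q))"
proof -
  let ?dark = "\<lambda>q j. \<exists>i. i \<rightarrow>\<^sup>*\<^bsub>with_proj T\<^esub> j \<and> i \<notin> (!) H ` {1..<q}"
  have "total_disruption d T H =
    (\<Sum>j = 1..n. \<Sum>q = 1..n. if ?dark q j then d (H ! (q - 1)) (H ! q) else 0)"
    using disruption_time_eq_sum[where d = d, OF assms] by (simp add: total_disruption_def assms(3))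
  also have "\<dots> = (\<Sum>q = 1..n. \<Sum>j = 1..n. if ?dark q j then d (H ! (q - 1)) (H ! q) else 0)"
    by (rule sum.swap)
  also have "\<dots> = (\<Sum>q = 1..n. real (without_power T ((!) H ` {1..<q})) * d (H ! (q - 1)) (H ! q))"
    by (intro sum.cong refl)
      (simp add: without_power_def assms(3) sum.If_cases Int_def)
  finally show ?thesis .
qed

lemma without_power_ge:
  assumes "finite (pverts T)"
  shows "card (pverts T - S) \<le> without_power T S"
  unfolding without_power_def
  using assms by (intro card_mono) (auto simp: reachable_def)

section \<open>The return path as the end of a solution\<close>

text \<open>
  The final depot is the only vertex of a return path that is not a customer, and the first
  vertex is a customer.
\<close>

lemma return_path_vertices:
  assumes "return_path n P"
  shows "length P = card (set P \<inter> {1..n}) + 1" and "1 \<le> card (set P \<inter> {1..n})"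
proof -
  have "distinct P" "set P \<subseteq> {0..n}" "P \<noteq> []" and ends: "hd P \<in> {1..n}" "last P = 0"
    using assms by (auto simp: return_path_def vpath_def vwalk_def road_network_def)
  then have "set P = insert 0 (set P \<inter> {1..n})"
    using last_in_set[of P] by force
  then have "card (set P) = Suc (card (set P \<inter> {1..n}))"
    by (metis Int_iff atLeastAtMost_iff card_insert_disjoint finite_Int finite_atLeastAtMost not_one_le_zero)
  then show "length P = card (set P \<inter> {1..n}) + 1"
    using distinct_card[OF \<open>distinct P\<close>] by simp
  have "hd P \<in> set P \<inter> {1..n}"
    using ends \<open>P \<noteq> []\<close> by simp
  then show "1 \<le> card (set P \<inter> {1..n})"
    by (metis One_nat_def Suc_leI card_gt_0_iff empty_iff finite_Int finite_atLeastAtMost)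
qed

lemma extended_from_nth:
  assumes "extended_from n H P" and "i < length P"
  shows "H ! (length H - length P + i) = P ! i"
proof -
  obtain Q where Q: "Q \<noteq> []" "P \<noteq> []" "last Q = hd P" "H = Q @ tl P"
    using assms(1) by (auto simp: extended_from_def joinable_def vwalk_join_def)
  then have "H = butlast Q @ P"
    by (metis append_Cons append_Nil append_assoc append_butlast_last_id list.collapse)
  then show ?thesis
    using Q(1) by (simp add: nth_append)
qed

text \<open>
  The vertex in position \<open>q\<close> of the return path (counted from 1) is the vertex in position
  \<open>n - k + q\<close> of the tour, so the customers outside of \<open>{i\<^sub>q, \<dots>, i\<^sub>k}\<close> are those visited at the
  positions before \<open>n - k + q\<close>.
\<close>

lemma return_disruption_eq_sum:
  assumes sol: "prtrp_solution n H" and ext: "extended_from n H P"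
    and P: "length P = k + 1" and k: "1 \<le> k" "k \<le> n" and verts: "pverts T = {1..n}"
  shows "return_disruption d T P =
    (\<Sum>q = n - k + 2..n. real (without_power T ((!) H ` {1..<q})) * d (H ! (q - 1)) (H ! q))"
proof -
  have nth: "P ! i = H ! (n + 1 - k + i)" if "i \<le> k" for i
    using extended_from_nth[OF ext, of i] that P length_solution[OF sol] by simp
  have rest: "pverts T - (\<lambda>q. P ! (q - 1)) ` {q..k} = (!) H ` {1..<n - k + q}"
    if q: "q \<in> {2..k}" for q
  proof -
    have "(\<lambda>q. P ! (q - 1)) ` {q..k} = (!) H ` {n - k + q..n}"
    proof -
      have "(\<lambda>q. P ! (q - 1)) ` {q..k} = (\<lambda>q. H ! (n - k + q)) ` {q..k}"
        using q k by (intro image_cong refl) (auto simp: nth)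
      also have "\<dots> = (!) H ` ((+) (n - k) ` {q..k})"
        by (rule image_image[symmetric])
      also have "(+) (n - k) ` {q..k} = {n - k + q..n}"
        using k by (simp only: image_add_atLeastAtMost le_add_diff_inverse add.commute[of q])
      finally show ?thesis .
    qed
    moreover have "{1..<n - k + q} = {1..n} - {n - k + q..n}"
      using q k by auto
    moreover have "(!) H ` ({1..n} - {n - k + q..n}) = (!) H ` {1..n} - (!) H ` {n - k + q..n}"
      using q by (intro inj_on_image_set_diff[OF inj_on_solution[OF sol]]) auto
    ultimately show ?thesis
      using verts image_solution[OF sol] by simp
  qed
  have "return_disruption d T P =
    (\<Sum>q = 2..k. real (without_power T ((!) H ` {1..<n - k + q})) * d (H ! (n - k + q - 1)) (H ! (n - k + q)))"
    unfolding return_disruption_def Let_def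
  proof (intro sum.cong)
    fix q assume "q \<in> {2..k}"
    moreover from this have "n + 1 - k + (q - 2) = n - k + q - 1" "n + 1 - k + (q - 1) = n - k + q"
      using k by auto
    ultimately show "real (without_power T (pverts T - (\<lambda>q. P ! (q - 1)) ` {q..length P - 1})) *
          d (P ! (q - 1 - 1)) (P ! (q - 1)) =
        real (without_power T ((!) H ` {1..<n - k + q})) * d (H ! (n - k + q - 1)) (H ! (n - k + q))"
      using P rest[of q] nth[of "q - 2"] nth[of "q - 1"] by (auto simp: numeral_2_eq_2)
  qed (simp add: P)
  also have "\<dots> = (\<Sum>q = n - k + 2..n.
      real (without_power T ((!) H ` {1..<q})) * d (H ! (q - 1)) (H ! q))"
    using k by (intro sum.reindex_bij_witness[of _ "\<lambda>q. q - (n - k)" "\<lambda>q. n - k + q"]) auto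
  finally show ?thesis .
qed

theorem proposition7:
  fixes n k :: nat
    and d :: "nat \<Rightarrow> nat \<Rightarrow> real"
    and T :: "nat pair_pre_digraph"
    and P H :: "nat list"
  assumes "n \<ge> 1"
    and "\<And>i j. (i, j) \<in> parcs (road_network n) \<Longrightarrow> d i j \<ge> 0"
    and "pverts T = {1..n}"
    and "rooted_directed_tree (with_proj T) 1"
    and "return_path n P"
    and "card (set P \<inter> {1..n}) = k"
    and "prtrp_solution n H"
    and "extended_from n H P"
  shows "total_disruption d T H \<ge>
    (\<Sum>p = 1..n - k + 1. real (n + 1 - p) * shortest_arc_length n d p) + return_disruption d T P"
proof -
  note sol = \<open>prtrp_solution n H\<close>
  let ?d = "\<lambda>q. d (H ! (q - 1)) (H ! q)"
  let ?W = "\<lambda>q. without_power T ((!) H ` {1..<q})"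
  have len_P: "length P = k + 1" and "1 \<le> k"
    using return_path_vertices[OF assms(5)] assms(6) by auto
  have "k \<le> n"
    using card_mono[of "{1..n}" "set P \<inter> {1..n}"] assms(6) by simp
  have W_ge: "n + 1 - q \<le> ?W q" if "q \<in> {1..n}" for q
  proof -
    have "n + 1 - q \<le> card ({1..n} - (!) H ` {1..<q})"
      using diff_card_le_card_Diff[of "(!) H ` {1..<q}" "{1..n}"] card_image_le[of "{1..<q}" "(!) H"] that
      by auto
    also have "\<dots> \<le> ?W q"
      using without_power_ge[of T] assms(3) by simp
    finally show ?thesis .
  qed
  have "(\<Sum>p = 1..n - k + 1. real (n + 1 - p) * shortest_arc_length n d p)
      \<le> (\<Sum>q = 1..n - k + 1. real (n + 1 - q) * ?d q)"
  proof (rule sum_antimono_weights_le)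
    fix j assume "j \<le> n - k + 1"
    then have "j \<le> n"
      using \<open>1 \<le> k\<close> \<open>k \<le> n\<close> by simp
    \<comment> \<open>The heads alone already distinguish the arcs.\<close>
    have "inj_on (\<lambda>q. (H ! (q - 1), H ! q)) {1..j}"
      using \<open>j \<le> n\<close> by (auto intro!: inj_onI dest!: inj_onD[OF inj_on_solution[OF sol]])
    then show "(\<Sum>p = 1..j. shortest_arc_length n d p) \<le> (\<Sum>q = 1..j. ?d q)"
      using sum_shortest_arc_length_le[of "\<lambda>q. (H ! (q - 1), H ! q)" j n d]
        solution_arc[OF sol] \<open>j \<le> n\<close> by simp
  qed auto
  also have "\<dots> \<le> (\<Sum>q = 1..n - k + 1. real (?W q) * ?d q)"
    using \<open>1 \<le> k\<close> \<open>k \<le> n\<close>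
    by (intro sum_mono mult_right_mono assms(2) solution_arc[OF sol] of_nat_mono W_ge) auto
  finally have "(\<Sum>p = 1..n - k + 1. real (n + 1 - p) * shortest_arc_length n d p)
      + return_disruption d T P
      \<le> (\<Sum>q = 1..n - k + 1. real (?W q) * ?d q) + (\<Sum>q = n - k + 2..n. real (?W q) * ?d q)"
    using return_disruption_eq_sum[OF sol assms(8) len_P \<open>1 \<le> k\<close> \<open>k \<le> n\<close> assms(3), of d] by simp
  also have "\<dots> = (\<Sum>q = 1..n. real (?W q) * ?d q)"
    using sum.ub_add_nat[of 1 "n - k + 1" "\<lambda>q. real (?W q) * ?d q" "k - 1"] \<open>1 \<le> k\<close> \<open>k \<le> n\<close>
    by simp
  also have "\<dots> = total_disruption d T H"
    using total_disruption_eq_sum[OF sol assms(2,3)] by simp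
  finally show ?thesis .
qed

end
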